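(* Let $m\ge2$ and let $C=(c_{jk})$ be an $m\times m$ cost matrix. For a scoring rule $L(j,q)$, define for each $q\in\Delta_m$ the nondecreasing function $$\psi_q(t)=\inf_{\eta'\in\Delta_m:\ \|\eta'-q\|_{\infty2}\ge t}B_L(\eta',q),\qquad t\ge0.$$ Then the regrets of the cost-weighted classification loss $L^{\mathrm{cw}}(j,q)$ and of the cost-transformed scoring rule $$\tilde L(j,q)=c_{jM}L(j,q)+\sum_{k\ne j}(c_{jM}-c_{jk})\{L(k,q)-1\},\qquad c_{jM}=\max_kc_{jk},$$ satisfy, for all $\eta,q\in\Delta_m$, $$\psi_q\left(\frac{B^{\mathrm{cw}}(\eta,q)}{1_m^{T}\tilde\eta}\right)\le\frac{B_{\tilde L}(\eta,q)}{1_m^{T}\tilde\eta},$$ where $\tilde\eta=(\tilde\eta_1,\ldots,\tilde\eta_m)^{T}$ with $\tilde\eta_j=c_{jM}\eta_j+\sum_{k\ne j}(c_{kM}-c_{kj})\eta_k$.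
   Context: $\Delta_m=\{q\in\mathbb R^m: q_j\ge0,\ \sum_jq_j=1\}$; $1_m$ is the all-ones vector; $\|b\|_{\infty2}=\max_{j\ne k}(|b_j|+|b_k|)$. A cost matrix $C=(C_1,\ldots,C_m)$ (columns $C_k$) has $c_{jk}\ge0$, $c_{jj}=0$, and for each $j$, $c_{jk}>0$ for some $k\ne j$. A scoring rule is a loss $L(j,q)$, $j\in\{1,\dots,m\}$, with action space $\Delta_m$ and values in $(-\infty,\infty]$ (with $0\cdot\infty=0$), whose generalized entropy $H_L(\eta)=\inf_{q\in\Delta_m}\sum_j\eta_jL(j,q)$ is finite. The regret is $B_L(\eta,q)=\sum_j\eta_jL(j,q)-H_L(\eta)$. The cost-weighted classification loss is $L^{\mathrm{cw}}(j,\gamma)=c_{jk}$ if $k=\mathrm{argmax}_l\gamma_l$, $\gamma\in\mathbb R^m$ (ties broken by any fixed rule), with regret $B^{\mathrm{cw}}(\eta,\gamma)=\sum_j\eta_jL^{\mathrm{cw}}(j,\gamma)-\min_k\eta^{T}C_k$. The infimum over an empty set is $+\infty$. *)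

theory Defs
  imports "HOL-Analysis.Analysis"
begin

definition prob_simplex :: "(real ^ 'm) set" where
  "prob_simplex = {q. (\<forall>j. 0 \<le> q $ j) \<and> (\<Sum>j\<in>UNIV. q $ j) = 1}"

text \<open>The maximum ranges over a nonempty set exactly when the index type has at least
  two elements.\<close>

definition norm_inf2 :: "real ^ 'm \<Rightarrow> real" where
  "norm_inf2 b = Max {\<bar>b $ j\<bar> + \<bar>b $ k\<bar> | j k. j \<noteq> k}"


text \<open>Losses are \<open>ereal\<close>-valued, where \<open>0 * \<infinity> = 0\<close> and the infimum of the empty set is
  \<open>\<infinity>\<close>. The first argument is the label, the second the action.\<close>

definition entropy :: "('m::finite \<Rightarrow> real ^ 'm \<Rightarrow> ereal) \<Rightarrow> real ^ 'm \<Rightarrow> ereal" where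
  "entropy L \<eta> = (INF q\<in>prob_simplex. \<Sum>j\<in>UNIV. ereal (\<eta> $ j) * L j q)"

definition regret ::
  "('m::finite \<Rightarrow> real ^ 'm \<Rightarrow> ereal) \<Rightarrow> real ^ 'm \<Rightarrow> real ^ 'm \<Rightarrow> ereal" where
  "regret L \<eta> q = (\<Sum>j\<in>UNIV. ereal (\<eta> $ j) * L j q) - entropy L \<eta>"

definition scoring_rule :: "('m::finite \<Rightarrow> real ^ 'm \<Rightarrow> ereal) \<Rightarrow> bool" where
  "scoring_rule L \<longleftrightarrow>
     (\<forall>j. \<forall>q\<in>prob_simplex. L j q \<noteq> -\<infinity>) \<and>
     (\<forall>\<eta>\<in>prob_simplex. \<bar>entropy L \<eta>\<bar> \<noteq> \<infinity>)"

definition psi ::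
  "('m::finite \<Rightarrow> real ^ 'm \<Rightarrow> ereal) \<Rightarrow> real ^ 'm \<Rightarrow> real \<Rightarrow> ereal" where
  "psi L q t = (INF \<eta>'\<in>{\<eta>' \<in> prob_simplex. norm_inf2 (\<eta>' - q) \<ge> t}. regret L \<eta>' q)"


text \<open>The entry \<open>C $ j $ k\<close> is the cost of choosing \<open>k\<close> when the true label is \<open>j\<close>.\<close>

definition cost_matrix :: "real ^ 'm ^ 'm \<Rightarrow> bool" where
  "cost_matrix C \<longleftrightarrow>
     (\<forall>j k. 0 \<le> C $ j $ k) \<and> (\<forall>j. C $ j $ j = 0) \<and> (\<forall>j. \<exists>k. k \<noteq> j \<and> 0 < C $ j $ k)"

definition max_cost :: "real ^ 'm ^ 'm \<Rightarrow> 'm \<Rightarrow> real" where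
  "max_cost C j = Max (range (\<lambda>k. C $ j $ k))"

text \<open>A tie-breaking rule is an arbitrary function that selects a maximizing index of
  every vector.\<close>

definition argmax_rule :: "(real ^ 'm \<Rightarrow> 'm) \<Rightarrow> bool" where
  "argmax_rule \<kappa> \<longleftrightarrow> (\<forall>\<gamma>. is_arg_max (\<lambda>l. \<gamma> $ l) (\<lambda>_. True) (\<kappa> \<gamma>))"

definition cw_loss ::
  "real ^ 'm ^ 'm \<Rightarrow> (real ^ 'm \<Rightarrow> 'm) \<Rightarrow> 'm \<Rightarrow> real ^ 'm \<Rightarrow> real" where
  "cw_loss C \<kappa> j \<gamma> = C $ j $ \<kappa> \<gamma>"

definition cw_regret ::
  "real ^ 'm ^ 'm \<Rightarrow> (real ^ 'm \<Rightarrow> 'm) \<Rightarrow> real ^ 'm \<Rightarrow> real ^ 'm \<Rightarrow> real" where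
  "cw_regret C \<kappa> \<eta> \<gamma> =
     (\<Sum>j\<in>UNIV. \<eta> $ j * cw_loss C \<kappa> j \<gamma>) - Min (range (\<lambda>k. \<eta> \<bullet> column k C))"

definition transformed_loss ::
  "real ^ 'm ^ 'm \<Rightarrow> ('m::finite \<Rightarrow> real ^ 'm \<Rightarrow> ereal) \<Rightarrow> 'm \<Rightarrow> real ^ 'm \<Rightarrow> ereal" where
  "transformed_loss C L j q =
     ereal (max_cost C j) * L j q +
     (\<Sum>k\<in>UNIV - {j}. ereal (max_cost C j - C $ j $ k) * (L k q - 1))"

definition transformed_weight :: "real ^ 'm ^ 'm \<Rightarrow> real ^ 'm \<Rightarrow> real ^ 'm" where
  "transformed_weight C \<eta> =
     (\<chi> j. max_cost C j * \<eta> $ j + (\<Sum>k\<in>UNIV - {j}. (max_cost C k - C $ k $ j) * \<eta> $ k))"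

end

theory Submission
  imports Defs
begin

text \<open>The expected transformed loss at \<open>\<eta>\<close> is, up to a constant not depending on the action, the
  expected loss of \<open>L\<close> under the unnormalized weights \<open>w\<close> = \<open>transformed_weight C \<eta>\<close>. With
  \<open>s\<close> the total weight and \<open>\<eta>'\<close> = \<open>w / s\<close>, the regret of the transformed rule is therefore \<open>s\<close>
  times the regret of \<open>L\<close> at \<open>\<eta>'\<close>. On the other side, \<open>w $ j\<close> differs from minus the expected cost of
  choosing \<open>j\<close> by a constant, so the cost-weighted regret divided by \<open>s\<close> is
  \<open>\<eta>' $ l - \<eta>' $ k\<close> with \<open>k\<close> the predicted label and \<open>l\<close> an optimal one. Since \<open>q $ l \<le> q $ k\<close>,
  this is at most \<open>norm_inf2 (\<eta>' - q)\<close>, hence \<open>\<eta>'\<close> is a competitor in the infimum defining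
  \<open>psi\<close>.\<close>

lemma max_cost_ge: "C $ j $ k \<le> max_cost C j"
  unfolding max_cost_def by (rule Max_ge) auto

lemma max_cost_pos:
  assumes "cost_matrix C"
  shows "0 < max_cost C j"
proof -
  obtain k where "0 < C $ j $ k"
    using assms unfolding cost_matrix_def by blast
  then show ?thesis
    using max_cost_ge[of C j k] by linarith
qed

text \<open>Since the diagonal costs vanish, the separate term for label \<open>j\<close> is just
  the summand \<open>k = j\<close>.\<close>

lemma transformed_weight_nth:
  assumes "cost_matrix C"
  shows "transformed_weight C \<eta> $ j = (\<Sum>k\<in>UNIV. (max_cost C k - C $ k $ j) * \<eta> $ k)"
  using assms unfolding transformed_weight_def cost_matrix_def
  by (subst sum.remove[of UNIV j]) auto

lemma transformed_weight_eq_minus_cost: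
  assumes "cost_matrix C"
  shows "transformed_weight C \<eta> $ j = (\<Sum>k\<in>UNIV. max_cost C k * \<eta> $ k) - \<eta> \<bullet> column j C"
  unfolding transformed_weight_nth[OF assms]
  by (simp add: inner_vec_def column_def algebra_simps sum_subtractf)

lemma transformed_weight_nonneg:
  assumes "cost_matrix C" "\<eta> \<in> prob_simplex"
  shows "0 \<le> transformed_weight C \<eta> $ j"
  unfolding transformed_weight_nth[OF assms(1)]
  using assms(2) max_cost_ge[of C _ j]
  by (intro sum_nonneg mult_nonneg_nonneg) (auto simp: prob_simplex_def)

text \<open>Some label \<open>k\<close> has positive probability, and every row of \<open>C\<close>
  has a positive entry, so the leading term of weight \<open>k\<close> is already positive.\<close>

lemma sum_transformed_weight_pos:
  assumes C: "cost_matrix C" and eta: "\<eta> \<in> prob_simplex"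
  shows "0 < (\<Sum>j\<in>UNIV. transformed_weight C \<eta> $ j)"
proof -
  have nn: "0 \<le> \<eta> $ k" for k
    using eta by (simp add: prob_simplex_def)
  have "(\<Sum>k\<in>UNIV. \<eta> $ k) \<noteq> 0"
    using eta by (simp add: prob_simplex_def)
  then obtain k where "\<eta> $ k \<noteq> 0"
    by (meson sum.neutral)
  then have "0 < max_cost C k * \<eta> $ k"
    using nn[of k] max_cost_pos[OF C, of k] by simp
  also have "\<dots> \<le> transformed_weight C \<eta> $ k"
    unfolding transformed_weight_def
    using nn max_cost_ge[of C _ k] by (auto intro!: sum_nonneg)
  also have "\<dots> \<le> (\<Sum>j\<in>UNIV. transformed_weight C \<eta> $ j)"
    using transformed_weight_nonneg[OF C eta] by (intro member_le_sum) auto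
  finally show ?thesis .
qed

lemma normalized_weight_in_simplex:
  assumes "cost_matrix C" "\<eta> \<in> prob_simplex"
  defines "s \<equiv> \<Sum>j\<in>UNIV. transformed_weight C \<eta> $ j"
  shows "transformed_weight C \<eta> /\<^sub>R s \<in> prob_simplex"
  using transformed_weight_nonneg[OF assms(1,2)] sum_transformed_weight_pos[OF assms(1,2)]
  unfolding prob_simplex_def s_def by (auto simp flip: sum_distrib_left)

text \<open>The sign condition matters: in \<open>ereal\<close> the sum of \<infinity> and
  -\<infinity> is \<infinity>, so a negative factor need not distribute.\<close>

lemma ereal_mult_sum:
  fixes f :: "'a \<Rightarrow> ereal"
  assumes "0 \<le> c"
  shows "ereal c * sum f A = (\<Sum>x\<in>A. ereal c * f x)"
  using sum_distrib_right_ereal[OF assms, of f A] by (simp add: mult.commute)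

lemma ereal_mult_add_real:
  assumes "0 \<le> c"
  shows "ereal c * (x + ereal d) = ereal c * x + ereal (c * d)"
  using distrib_left_ereal_nn[OF assms, of x "ereal d"] by (simp add: mult.commute)

lemma transformed_loss_affine:
  assumes C: "cost_matrix C"
  shows "transformed_loss C L j q =
    (\<Sum>k\<in>UNIV. ereal (max_cost C j - C $ j $ k) * L k q)
      + ereal (\<Sum>k\<in>UNIV - {j}. C $ j $ k - max_cost C j)"
proof -
  have *: "ereal (max_cost C j - C $ j $ k) * (L k q - 1)
      = ereal (max_cost C j - C $ j $ k) * L k q + ereal (C $ j $ k - max_cost C j)" for k
    using ereal_mult_add_real[of "max_cost C j - C $ j $ k" "L k q" "-1"] max_cost_ge[of C j k]
    by (simp add: minus_ereal_def one_ereal_def)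
  have "C $ j $ j = 0"
    using C by (simp add: cost_matrix_def)
  then show ?thesis
    unfolding transformed_loss_def *
    by (simp add: sum.remove[of UNIV j "\<lambda>k. ereal (max_cost C j - C $ j $ k) * L k q"]
        sum.distrib add.assoc)
qed

lemma expected_transformed_loss:
  assumes C: "cost_matrix C" and eta: "\<eta> \<in> prob_simplex"
  shows "(\<Sum>j\<in>UNIV. ereal (\<eta> $ j) * transformed_loss C L j q) =
    (\<Sum>k\<in>UNIV. ereal (transformed_weight C \<eta> $ k) * L k q)
      + ereal (\<Sum>j\<in>UNIV. \<eta> $ j * (\<Sum>k\<in>UNIV - {j}. C $ j $ k - max_cost C j))"
proof -
  let ?a = "\<lambda>j k. max_cost C j - C $ j $ k"
  have nn: "0 \<le> \<eta> $ j" for j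
    using eta by (simp add: prob_simplex_def)
  have ann: "0 \<le> ?a j k" for j k
    using max_cost_ge[of C j k] by simp
  have "(\<Sum>j\<in>UNIV. ereal (\<eta> $ j) * (\<Sum>k\<in>UNIV. ereal (?a j k) * L k q))
      = (\<Sum>j\<in>UNIV. \<Sum>k\<in>UNIV. ereal (?a j k * \<eta> $ j) * L k q)"
    by (simp add: ereal_mult_sum[OF nn] mult.assoc[symmetric] mult.commute[of "\<eta> $ _"])
  \<comment> \<open>Summing over labels first leaves one common factor \<open>L k q\<close>; its
    coefficients are nonnegative, so they add up even where the loss is infinite.\<close>
  also have "\<dots> = (\<Sum>k\<in>UNIV. \<Sum>j\<in>UNIV. ereal (?a j k * \<eta> $ j) * L k q)"
    by (rule sum.swap)
  also have "\<dots> = (\<Sum>k\<in>UNIV. ereal (transformed_weight C \<eta> $ k) * L k q)"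
    using nn ann
    by (simp add: transformed_weight_nth[OF C] sum_ereal_left_distrib[symmetric])
  finally show ?thesis
    by (simp add: transformed_loss_affine[OF C] ereal_mult_add_real[OF nn] sum.distrib)
qed

text \<open>An increasing bijection of \<open>ereal\<close> commutes with every infimum, that of the
  empty set included.\<close>

lemma INF_ereal_affine:
  fixes f :: "'a \<Rightarrow> ereal"
  assumes "0 < s"
  shows "(INF x\<in>A. ereal s * f x + ereal d) = ereal s * (INF x\<in>A. f x) + ereal d"
proof -
  let ?T = "\<lambda>x. ereal s * x + ereal d"
  have "mono ?T"
    using assms by (auto intro!: monoI add_right_mono ereal_mult_left_mono)
  moreover have "bij ?T"
  proof (rule o_bij)
    show "(\<lambda>y. ereal (inverse s) * (y + ereal (- d))) \<circ> ?T = id"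
    proof
      fix x show "((\<lambda>y. ereal (inverse s) * (y + ereal (- d))) \<circ> ?T) x = id x"
        using assms by (cases x) auto
    qed
    show "?T \<circ> (\<lambda>y. ereal (inverse s) * (y + ereal (- d))) = id"
    proof
      fix x show "(?T \<circ> (\<lambda>y. ereal (inverse s) * (y + ereal (- d)))) x = id x"
        using assms by (cases x) (auto simp: mult.assoc[symmetric])
    qed
  qed
  ultimately show ?thesis
    using mono_bij_Inf[of ?T "f ` A"] by (simp add: image_image)
qed

lemma regret_transformed_loss:
  assumes C: "cost_matrix C" and eta: "\<eta> \<in> prob_simplex"
  defines "s \<equiv> \<Sum>j\<in>UNIV. transformed_weight C \<eta> $ j"
  assumes fin: "\<bar>entropy L (transformed_weight C \<eta> /\<^sub>R s)\<bar> \<noteq> \<infinity>"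
  shows "regret (transformed_loss C L) \<eta> q
    = ereal s * regret L (transformed_weight C \<eta> /\<^sub>R s) q"
proof -
  let ?e = "transformed_weight C \<eta> /\<^sub>R s"
  define X where "X q = (\<Sum>k\<in>UNIV. ereal (?e $ k) * L k q)" for q
  define d where "d = (\<Sum>j\<in>UNIV. \<eta> $ j * (\<Sum>k\<in>UNIV - {j}. C $ j $ k - max_cost C j))"
  have s: "0 < s"
    unfolding s_def by (rule sum_transformed_weight_pos[OF C eta])
  have E: "(\<Sum>j\<in>UNIV. ereal (\<eta> $ j) * transformed_loss C L j q) = ereal s * X q + ereal d" for q
    using s unfolding expected_transformed_loss[OF C eta] X_def d_def
    by (simp add: ereal_mult_sum mult.assoc[symmetric])
  have H: "entropy (transformed_loss C L) \<eta> = ereal s * entropy L ?e + ereal d"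
    unfolding entropy_def E INF_ereal_affine[OF s] X_def ..
  have "regret (transformed_loss C L) \<eta> q
      = (ereal s * X q + ereal d) - (ereal s * entropy L ?e + ereal d)"
    unfolding regret_def E H ..
  \<comment> \<open>Finiteness of the entropy allows \<open>d\<close> to cancel and rules out a
    difference of two infinities, even when \<open>X q\<close> is infinite.\<close>
  also have "\<dots> = ereal s * (X q - entropy L ?e)"
    using fin s by (cases "X q"; cases "entropy L ?e") (auto simp: algebra_simps)
  finally show ?thesis
    unfolding regret_def X_def .
qed

lemma norm_inf2_ge:
  fixes b :: "real ^ 'm::finite"
  assumes "j \<noteq> k"
  shows "\<bar>b $ j\<bar> + \<bar>b $ k\<bar> \<le> norm_inf2 b"
proof -
  have "finite {\<bar>b $ j\<bar> + \<bar>b $ k\<bar> | j k. j \<noteq> k}"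
    by (rule finite_subset[of _ "(\<lambda>(j, k). \<bar>b $ j\<bar> + \<bar>b $ k\<bar>) ` UNIV"]) auto
  then show ?thesis
    unfolding norm_inf2_def using assms by (intro Max_ge) auto
qed

text \<open>Two distinct labels bound the maximum below by a sum of absolute values.\<close>

lemma norm_inf2_nonneg:
  fixes b :: "real ^ 'm::finite"
  assumes "2 \<le> CARD('m)"
  shows "0 \<le> norm_inf2 b"
proof -
  have "\<not> is_singleton (UNIV :: 'm set)"
    using assms by (auto simp: is_singleton_altdef)
  then obtain j k :: 'm where "j \<noteq> k"
    by (metis (full_types) UNIV_I UNIV_not_empty is_singletonI')
  then show ?thesis
    using norm_inf2_ge[of j k b] by linarith
qed

lemma cw_regret_eq_weight_diff:
  assumes C: "cost_matrix C"
  obtains l where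
    "cw_regret C \<kappa> \<eta> q = transformed_weight C \<eta> $ l - transformed_weight C \<eta> $ \<kappa> q"
proof -
  have "Min (range (\<lambda>k. \<eta> \<bullet> column k C)) \<in> range (\<lambda>k. \<eta> \<bullet> column k C)"
    by (rule Min_in) auto
  then obtain l where l: "Min (range (\<lambda>k. \<eta> \<bullet> column k C)) = \<eta> \<bullet> column l C"
    by blast
  have "cw_regret C \<kappa> \<eta> q = \<eta> \<bullet> column (\<kappa> q) C - \<eta> \<bullet> column l C"
    unfolding cw_regret_def l by (simp add: inner_vec_def column_def cw_loss_def)
  then show ?thesis
    by (intro that[of l]) (simp add: transformed_weight_eq_minus_cost[OF C])
qed

lemma cw_regret_le_norm_inf2:
  fixes C :: "real ^ 'm::finite ^ 'm"
  assumes m: "2 \<le> CARD('m)" and C: "cost_matrix C" and \<kappa>: "argmax_rule \<kappa>"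
    and eta: "\<eta> \<in> prob_simplex"
  defines "s \<equiv> \<Sum>j\<in>UNIV. transformed_weight C \<eta> $ j"
  shows "cw_regret C \<kappa> \<eta> q / s \<le> norm_inf2 (transformed_weight C \<eta> /\<^sub>R s - q)"
proof -
  let ?e = "transformed_weight C \<eta> /\<^sub>R s"
  obtain l where "cw_regret C \<kappa> \<eta> q
      = transformed_weight C \<eta> $ l - transformed_weight C \<eta> $ \<kappa> q"
    using cw_regret_eq_weight_diff[OF C] .
  then have l: "cw_regret C \<kappa> \<eta> q / s = ?e $ l - ?e $ \<kappa> q"
    by (simp add: divide_inverse right_diff_distrib mult.commute[of _ "inverse s"])
  show ?thesis
  proof (cases "l = \<kappa> q")
    \<comment> \<open>The prediction is optimal and the regret is zero; \<open>norm_inf2\<close>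
      controls only pairs of distinct indices, so nonnegativity is used instead.\<close>
    case True
    then show ?thesis
      unfolding l by (simp add: norm_inf2_nonneg[OF m])
  next
    case False
    have "q $ l \<le> q $ \<kappa> q"
      using \<kappa> unfolding argmax_rule_def is_arg_max_linorder by blast
    \<comment> \<open>Add and subtract \<open>q\<close> in both coordinates: the leftover
      \<open>q $ l - q $ \<kappa> q\<close> is at most zero.\<close>
    then have "?e $ l - ?e $ \<kappa> q \<le> \<bar>(?e - q) $ l\<bar> + \<bar>(?e - q) $ \<kappa> q\<bar>"
      unfolding vector_minus_component by linarith
    then show ?thesis
      using norm_inf2_ge[OF False, of "?e - q"] l by linarith
  qed
qed

text \<open>Raising the threshold shrinks the set of competitors, so the infimum can only
  grow.\<close>

lemma psi_mono: "mono (psi L q)"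
  unfolding psi_def by (intro monoI INF_superset_mono) auto

theorem proposition11:
  fixes C :: "real ^ 'm ^ 'm"
    and L :: "'m::finite \<Rightarrow> real ^ 'm \<Rightarrow> ereal"
    and \<kappa> :: "real ^ 'm \<Rightarrow> 'm"
  assumes "2 \<le> CARD('m)"
    and "cost_matrix C"
    and "scoring_rule L"
    and "argmax_rule \<kappa>"
  shows "(\<forall>q\<in>prob_simplex. mono_on {0..} (psi L q)) \<and>
    (\<forall>\<eta>\<in>prob_simplex. \<forall>q\<in>prob_simplex.
       psi L q (cw_regret C \<kappa> \<eta> q / (\<Sum>j\<in>UNIV. transformed_weight C \<eta> $ j))
         \<le> regret (transformed_loss C L) \<eta> q / ereal (\<Sum>j\<in>UNIV. transformed_weight C \<eta> $ j))"
proof (intro conjI ballI)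
  show "mono_on {0..} (psi L q)" for q
    by (rule mono_on_subset[OF psi_mono]) simp
next
  fix \<eta> q :: "real ^ 'm"
  assume eta: "\<eta> \<in> prob_simplex" and "q \<in> prob_simplex"
  define s where "s = (\<Sum>j\<in>UNIV. transformed_weight C \<eta> $ j)"
  let ?e = "transformed_weight C \<eta> /\<^sub>R s"
  have s: "0 < s"
    unfolding s_def by (rule sum_transformed_weight_pos[OF assms(2) eta])
  have e: "?e \<in> prob_simplex"
    unfolding s_def by (rule normalized_weight_in_simplex[OF assms(2) eta])
  then have "\<bar>entropy L ?e\<bar> \<noteq> \<infinity>"
    using assms(3) by (simp add: scoring_rule_def)
  then have R: "regret (transformed_loss C L) \<eta> q = ereal s * regret L ?e q"
    unfolding s_def by (rule regret_transformed_loss[OF assms(2) eta])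
  have "psi L q (cw_regret C \<kappa> \<eta> q / s) \<le> regret L ?e q"
    unfolding psi_def using e cw_regret_le_norm_inf2[OF assms(1,2,4) eta, of q]
    by (intro INF_lower) (simp add: s_def)
  also have "\<dots> = regret (transformed_loss C L) \<eta> q / ereal s"
    unfolding R using s by (cases "regret L ?e q") auto
  finally show "psi L q (cw_regret C \<kappa> \<eta> q / (\<Sum>j\<in>UNIV. transformed_weight C \<eta> $ j))
      \<le> regret (transformed_loss C L) \<eta> q / ereal (\<Sum>j\<in>UNIV. transformed_weight C \<eta> $ j)"
    unfolding s_def .
qed

end
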